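(* Let $r,s\ge 1$ and let $p_1,\dots,p_r,q_1,\dots,q_s$ be positive integers with $\{p_1,\dots,p_r\}\cap\{q_1,\dots,q_s\}=\emptyset$, $q_s=1$, and $\sum_{i=1}^r p_i=\sum_{j=1}^s q_j=:L$. Put $n=r+s-1$. Let $\alpha$ be the multiset $\bigcup_{j=1}^r\{\tfrac{i}{p_j}:1\le i\le p_j\}$ and $\beta$ the multiset $\bigcup_{j=1}^s\{\tfrac{i}{q_j}:1\le i\le q_j\}$; each has $L$ elements in $(0,1]$. Sort the $2L$ elements of $\alpha$ and $\beta$ together (each element remembering which multiset it came from) as $\mu_1\le\mu_2\le\cdots\le\mu_{2L}$, with the convention that when a value occurs in both $\alpha$ and $\beta$, all copies coming from $\beta$ are placed before all copies coming from $\alpha$. Define $\Phi(0)=r$ and, for $1\le i\le 2L$, $\Phi(i)=\Phi(i-1)+1$ if $\mu_i$ comes from $\alpha$ and $\Phi(i)=\Phi(i-1)-1$ if $\mu_i$ comes from $\beta$. Let $\Delta$ be the convex polyhedron in $\mathbb R^n$ with vertices the origin and ${\bf e}_0,\dots,{\bf e}_n$, where ${\bf e}_0=[1,0,\dots,0]$, ${\bf e}_i$ ($1\le i\le n-1$) has first coordinate $1$, $(i+1)$-st coordinate $1$ and all other coordinates $0$, and ${\bf e}_n=[1,p_1,\dots,p_{r-1},-q_1,\dots,-q_{s-1}]$. Let $H_\Delta(k)$ be the Hodge numbers of $\Delta$ as defined in the context. Then for every integer $k$, $$H_\Delta(k)=\#\{\,i\in\{1,\dots,2L\}:\ \mu_i\text{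 comes from }\beta\text{ and }\Phi(i)=k\,\}.$$
   Context: Let $C(\Delta)=\{\sum_{i=0}^n c_i{\bf e}_i: c_i\in\mathbb R_{\ge0}\}$ be the cone over $\Delta$. The weight of a point $v\in C(\Delta)$ is the smallest real $w\ge0$ with $v\in w\Delta$; since all ${\bf e}_i$ lie on the hyperplane $x_1=1$, it equals the first coordinate of $v$. Set $w_\Delta(0)=1$, $w_\Delta(k)=0$ for $k<0$, and for $k\ge1$ let $w_\Delta(k)$ be the number of lattice points $v\in C(\Delta)\cap\mathbb Z^n$ of weight $k$. The Hodge numbers are $H_\Delta(k)=\sum_{i=0}^n(-1)^i\binom{n}{i}w_\Delta(k-i)$. *)

theory Defs
  imports "HOL-Analysis.Analysis" "HOL-Library.Multiset"
begin

text \<open>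
  Some \<open>e i\<close> may fail to be an extreme point: for \<open>r = 1\<close> below, \<open>e 0\<close> is a convex
  combination of the others.
\<close>

definition polytope_of :: "nat \<Rightarrow> (nat \<Rightarrow> real ^ 'n) \<Rightarrow> (real ^ 'n) set" where
  "polytope_of n e = convex hull (insert 0 (e ` {0..n}))"

definition cone_of :: "nat \<Rightarrow> (nat \<Rightarrow> real ^ 'n) \<Rightarrow> (real ^ 'n) set" where
  "cone_of n e = {(\<Sum>i=0..n. c i *\<^sub>R e i) | c. \<forall>i\<in>{0..n}. 0 \<le> c i}"

definition weight :: "(real ^ 'n) set \<Rightarrow> real ^ 'n \<Rightarrow> real" where
  "weight D v = (LEAST w. 0 \<le> w \<and> v \<in> (\<lambda>x. w *\<^sub>R x) ` D)"

text \<open>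
  The set counted below is finite for the vectors \<open>vert\<close> defined later, because it
  consists of lattice points of the bounded set \<open>k\<Delta>\<close>.
\<close>

definition weight_count :: "nat \<Rightarrow> (nat \<Rightarrow> real ^ 'n) \<Rightarrow> int \<Rightarrow> nat" where
  "weight_count n e k =
     (if k < 0 then 0
      else if k = 0 then 1
      else card {v \<in> cone_of n e. (\<forall>j. v $ j \<in> \<int>) \<and>
                   weight (polytope_of n e) v = real_of_int k})"

definition hodge :: "nat \<Rightarrow> (nat \<Rightarrow> real ^ 'n) \<Rightarrow> int \<Rightarrow> int" where
  "hodge n e k =
     (\<Sum>i=0..n. (-1) ^ i * int (n choose i) * int (weight_count n e (k - int i)))"

text \<open>
  The coordinates of \<open>real ^ 'n\<close> are numbered \<open>1, \<dots>, n\<close>, where \<open>n = r + s - 1\<close>, by a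
  bijection \<open>pos :: 'n \<Rightarrow> nat\<close> onto \<open>{1..n}\<close>.
  Coordinates \<open>2, \<dots>, r\<close> of \<open>e n\<close> are \<open>p 1, \<dots>, p (r - 1)\<close> and coordinates
  \<open>r + 1, \<dots>, r + s - 1\<close> are \<open>- q 1, \<dots>, - q (s - 1)\<close>.
\<close>

definition vert_coord ::
  "nat \<Rightarrow> nat \<Rightarrow> (nat \<Rightarrow> nat) \<Rightarrow> (nat \<Rightarrow> nat) \<Rightarrow> nat \<Rightarrow> nat \<Rightarrow> real" where
  "vert_coord r s p q i m =
     (if i = 0 then (if m = 1 then 1 else 0)
      else if i < r + s - 1 then (if m = 1 \<or> m = i + 1 then 1 else 0)
      else (if m = 1 then 1
            else if m \<le> r then real (p (m - 1))
            else - real (q (m - r))))"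

definition vert ::
  "('n \<Rightarrow> nat) \<Rightarrow> nat \<Rightarrow> nat \<Rightarrow> (nat \<Rightarrow> nat) \<Rightarrow> (nat \<Rightarrow> nat) \<Rightarrow> nat \<Rightarrow> real ^ 'n" where
  "vert pos r s p q i = (\<chi> j. vert_coord r s p q i (pos j))"

datatype origin = Alpha | Beta

definition fracs :: "nat \<Rightarrow> (nat \<Rightarrow> nat) \<Rightarrow> real multiset" where
  "fracs t p = (\<Sum>j=1..t. image_mset (\<lambda>i. real i / real (p j)) (mset_set {1..p j}))"

definition tagged_fracs ::
  "nat \<Rightarrow> nat \<Rightarrow> (nat \<Rightarrow> nat) \<Rightarrow> (nat \<Rightarrow> nat) \<Rightarrow> (real \<times> origin) multiset" where
  "tagged_fracs r s p q =
     image_mset (\<lambda>x. (x, Alpha)) (fracs r p) + image_mset (\<lambda>x. (x, Beta)) (fracs s q)"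

text \<open>At equal values, an element of origin \<open>Alpha\<close> never precedes one of origin \<open>Beta\<close>.\<close>

definition beta_first_le :: "real \<times> origin \<Rightarrow> real \<times> origin \<Rightarrow> bool" where
  "beta_first_le x y \<longleftrightarrow>
     fst x < fst y \<or> (fst x = fst y \<and> \<not> (snd x = Alpha \<and> snd y = Beta))"

definition is_merged_sort ::
  "nat \<Rightarrow> nat \<Rightarrow> (nat \<Rightarrow> nat) \<Rightarrow> (nat \<Rightarrow> nat) \<Rightarrow> (real \<times> origin) list \<Rightarrow> bool" where
  "is_merged_sort r s p q \<mu> \<longleftrightarrow>
     mset \<mu> = tagged_fracs r s p q \<and> sorted_wrt beta_first_le \<mu>"

text \<open>Lists are indexed from \<open>0\<close>, so the \<open>i\<close>-th element of the sequence is \<open>\<mu> ! (i - 1)\<close>.\<close>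

primrec Phi :: "nat \<Rightarrow> (real \<times> origin) list \<Rightarrow> nat \<Rightarrow> int" where
  "Phi r \<mu> 0 = int r"
| "Phi r \<mu> (Suc i) = (case snd (\<mu> ! i) of Alpha \<Rightarrow> Phi r \<mu> i + 1 | Beta \<Rightarrow> Phi r \<mu> i - 1)"

lemma ex1_is_merged_sort: "\<exists>!\<mu>. is_merged_sort r s p q \<mu>"
proof (rule ex_ex1I)
  have ins: "\<exists>ys. mset ys = mset xs \<and> sorted_wrt beta_first_le ys"
    for xs :: "(real \<times> origin) list"
  proof (induction xs)
    case Nil
    then show ?case by auto
  next
    case (Cons x xs)
    then obtain ys where ys: "mset ys = mset xs" "sorted_wrt beta_first_le ys" by auto
    let ?l = "filter (\<lambda>y. beta_first_le y x) ys"
    let ?g = "filter (\<lambda>y. \<not> beta_first_le y x) ys"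
    have tr: "beta_first_le u w" if "beta_first_le u v" "beta_first_le v w" for u v w
      using that by (cases "snd u"; cases "snd v"; cases "snd w") (auto simp: beta_first_le_def)
    have tot: "beta_first_le u v \<or> beta_first_le v u" for u v
      by (auto simp: beta_first_le_def)
    have "sorted_wrt beta_first_le (?l @ x # ?g)"
      unfolding sorted_wrt_append sorted_wrt.simps set_filter list.set
      using ys(2) tr tot by (blast intro: sorted_wrt_filter)
    moreover have "mset (?l @ x # ?g) = mset (x # xs)"
      using ys(1) by (simp add: mset_filter flip: multiset_partition)
    ultimately show ?case by blast
  qed
  obtain xs where "mset xs = tagged_fracs r s p q"
    using ex_mset by blast
  with ins[of xs] show "\<exists>\<mu>. is_merged_sort r s p q \<mu>"
    by (auto simp: is_merged_sort_def)
next
  fix \<mu> \<nu>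
  assume "is_merged_sort r s p q \<mu>" "is_merged_sort r s p q \<nu>"
  then have "mset \<mu> = mset \<nu>" "sorted_wrt beta_first_le \<mu>" "sorted_wrt beta_first_le \<nu>"
    by (auto simp: is_merged_sort_def)
  moreover have anti: "x = y" if "beta_first_le x y" "beta_first_le y x" for x y
    using that by (cases x; cases y; cases "snd x"; cases "snd y") (auto simp: beta_first_le_def)
  ultimately show "\<mu> = \<nu>"
  proof (induction \<mu> arbitrary: \<nu>)
    case Nil
    then show ?case by simp
  next
    case (Cons x xs)
    then obtain y ys where nu: "\<nu> = y # ys" by (cases \<nu>) auto
    have "x \<in> set \<nu>" "y \<in> set (x # xs)"
      using Cons.prems(1) nu by (metis list.set_intros(1) set_mset_mset)+
    then have "x = y" using Cons.prems(2,3) nu anti[of x y] by (simp del: split_paired_All) blast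
    then show ?case using Cons nu by auto
  qed
qed

end

(*
  The vertices satisfy one linear relation: the sum of the d_i e_i vanishes, where d lists the p_j
  and the -q_j, and d_n = -1.  The lattice points of the cone are the integer combinations of the
  e_i modulo the integer multiples of d, so each has exactly one representation by integers z_i such
  that z_i >= d_i x for all i, with equality for some i having d_i < 0, for some x in (0,1].
  Only the finitely many x that occur in beta contribute, and for a fixed x the number of such z
  with sum k is g(k - A) - g(k - A - m), where g(k) counts the (n+1)-tuples of natural numbers with
  sum k, A is the sum of the ceilings of the d_i x, and m is the multiplicity of x in beta.  The
  n-th backward difference turns this into the indicator function of A <= k < A + m.  On the other
  side, Phi equals A + m just before the copies of x that come from beta, and takes the values
  A + m - 1, ..., A on them.
*)
theory Submission
  imports Defs
begin

section \<open>Integer tuples with lower bounds, and backward differences of their number\<close>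

text \<open>The tuples have the \<open>n + 1\<close> entries \<open>z 0, ..., z n\<close>. Requiring
  zeros beyond \<open>n\<close> makes each tuple a single function, so that cardinalities count
  tuples.\<close>

definition tuples :: "nat \<Rightarrow> (nat \<Rightarrow> int) \<Rightarrow> int \<Rightarrow> (nat \<Rightarrow> int) set" where
  "tuples n l k = {z. (\<forall>i\<le>n. l i \<le> z i) \<and> (\<forall>i>n. z i = 0) \<and> (\<Sum>i\<le>n. z i) = k}"

lemma tuples_0: "tuples 0 l k = (if l 0 \<le> k then {(\<lambda>i. 0)(0 := k)} else {})"
  by (auto simp: tuples_def fun_eq_iff)

text \<open>Dropping a prescribed last entry \<open>a\<close> lowers the sum by \<open>a\<close>.
  Replacing the last bound by \<open>a\<close> allows any value there: finiteness uses every
  possible last entry, the counting recursion only \<open>a = l (Suc n)\<close>.\<close>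

lemma tuples_Suc_face:
  "bij_betw (\<lambda>z. z(Suc n := a)) (tuples n l (k - a))
     {z \<in> tuples (Suc n) (l(Suc n := a)) k. z (Suc n) = a}"
proof (rule bij_betw_byWitness[where f' = "\<lambda>z. z(Suc n := 0)"])
  have s: "sum (z(Suc n := b)) {..n} = sum z {..n}" for z :: "nat \<Rightarrow> int" and b
    by (intro sum.cong) auto
  show "\<forall>z\<in>tuples n l (k - a). (z(Suc n := a))(Suc n := 0) = z"
    by (auto simp: tuples_def fun_eq_iff)
  show "\<forall>z\<in>{z \<in> tuples (Suc n) (l(Suc n := a)) k. z (Suc n) = a}.
      (z(Suc n := 0))(Suc n := a) = z"
    by (auto simp: fun_eq_iff)
  show "(\<lambda>z. z(Suc n := a)) ` tuples n l (k - a)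
      \<subseteq> {z \<in> tuples (Suc n) (l(Suc n := a)) k. z (Suc n) = a}"
    by (auto simp: tuples_def s)
  show "(\<lambda>z. z(Suc n := 0)) ` {z \<in> tuples (Suc n) (l(Suc n := a)) k. z (Suc n) = a}
      \<subseteq> tuples n l (k - a)"
  proof clarsimp
    fix z assume z: "z \<in> tuples (Suc n) (l(Suc n := z (Suc n))) k" "a = z (Suc n)"
    have "l i \<le> z i" if "i \<le> n" for i
    proof -
      have "(l(Suc n := z (Suc n))) i \<le> z i"
        using z(1) that by (auto simp: tuples_def simp del: fun_upd_apply)
      then show ?thesis using that by simp
    qed
    then show "z(Suc n := 0) \<in> tuples n l (k - z (Suc n))"
      using z by (auto simp: tuples_def s)
  qed
qed

lemma finite_tuples: "finite (tuples n l k)"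
proof (induction n arbitrary: k)
  case 0
  show ?case by (simp add: tuples_0)
next
  case (Suc n)
  let ?A = "{l (Suc n)..k - (\<Sum>i\<le>n. l i)}"
  have "tuples (Suc n) l k \<subseteq> (\<Union>a\<in>?A. (\<lambda>z. z(Suc n := a)) ` tuples n l (k - a))"
  proof
    fix z assume z: "z \<in> tuples (Suc n) l k"
    then have "(\<Sum>i\<le>n. l i) \<le> (\<Sum>i\<le>n. z i)"
      by (intro sum_mono) (auto simp: tuples_def)
    with z have "z (Suc n) \<in> ?A" by (auto simp: tuples_def)
    moreover have "z \<in> (\<lambda>w. w(Suc n := z (Suc n))) ` tuples n l (k - z (Suc n))"
    proof -
      have "z \<in> {y \<in> tuples (Suc n) (l(Suc n := z (Suc n))) k. y (Suc n) = z (Suc n)}"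
        using z by (auto simp: tuples_def)
      then show ?thesis using tuples_Suc_face[of n "z (Suc n)" l k] by (simp add: bij_betw_def)
    qed
    ultimately show "z \<in> (\<Union>a\<in>?A. (\<lambda>z. z(Suc n := a)) ` tuples n l (k - a))" by blast
  qed
  then show ?case
    by (rule finite_subset) (use Suc in auto)
qed

text \<open>Raising the last entry by one maps the tuples of sum \<open>k - 1\<close> onto those of
  sum \<open>k\<close> whose last entry exceeds its bound. The difference therefore counts the
  tuples whose last entry equals its bound.\<close>

lemma card_tuples_Suc:
  "int (card (tuples (Suc n) l k)) - int (card (tuples (Suc n) l (k - 1)))
     = int (card (tuples n l (k - l (Suc n))))"
proof -
  let ?F = "{z \<in> tuples (Suc n) l k. z (Suc n) = l (Suc n)}"
  let ?G = "{z \<in> tuples (Suc n) l k. z (Suc n) > l (Suc n)}"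
  have s: "sum (z(Suc n := b)) {..n} = sum z {..n}" for z :: "nat \<Rightarrow> int" and b
    by (intro sum.cong) auto
  have "bij_betw (\<lambda>z. z(Suc n := z (Suc n) + 1)) (tuples (Suc n) l (k - 1)) ?G"
    by (rule bij_betw_byWitness[where f' = "\<lambda>z. z(Suc n := z (Suc n) - 1)"])
      (auto simp: tuples_def s fun_eq_iff, metis add_increasing2 order_refl zero_le_one)
  then have "card ?G = card (tuples (Suc n) l (k - 1))"
    by (simp add: bij_betw_same_card)
  moreover have "card ?F = card (tuples n l (k - l (Suc n)))"
    using bij_betw_same_card[OF tuples_Suc_face[of n "l (Suc n)" l k]] by simp
  moreover have "card (tuples (Suc n) l k) = card ?F + card ?G"
  proof -
    have u: "?F \<union> ?G = tuples (Suc n) l k" by (force simp: tuples_def)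
    have "finite ?F" "finite ?G" "?F \<inter> ?G = {}" by (auto simp: finite_tuples)
    then have "card (?F \<union> ?G) = card ?F + card ?G" by (rule card_Un_disjoint)
    then show ?thesis unfolding u .
  qed
  ultimately show ?thesis by simp
qed

text \<open>The \<open>n\<close>-fold iterate of the backward difference
  \<open>f k - f (k - 1)\<close>, written out with binomial coefficients to match
  \<open>hodge\<close>.\<close>

definition bdiff :: "nat \<Rightarrow> (int \<Rightarrow> int) \<Rightarrow> int \<Rightarrow> int" where
  "bdiff n f k = (\<Sum>i=0..n. (-1) ^ i * int (n choose i) * f (k - int i))"

lemma bdiff_Suc: "bdiff (Suc n) f k = bdiff n (\<lambda>k. f k - f (k - 1)) k"
proof -
  let ?g = "\<lambda>i. (-1) ^ i * int (n choose i) * f (k - int i)"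
  let ?h = "\<lambda>i. (-1) ^ Suc i * int (n choose i) * f (k - int (Suc i))"
  have "bdiff (Suc n) f k
      = f k + (\<Sum>i=0..n. (-1) ^ Suc i * int (Suc n choose Suc i) * f (k - int (Suc i)))"
    unfolding bdiff_def by (simp only: sum.atLeast0_atMost_Suc_shift) (simp add: comp_def)
  \<comment> \<open>Pascal's rule splits each coefficient.\<close>
  also have "(\<Sum>i=0..n. (-1) ^ Suc i * int (Suc n choose Suc i) * f (k - int (Suc i)))
      = (\<Sum>i=0..n. ?h i) + (\<Sum>i=0..n. ?g (Suc i))"
    unfolding sum.distrib[symmetric] by (intro sum.cong) (auto simp: algebra_simps)
  also have "f k + \<dots> = (\<Sum>i=0..Suc n. ?g i) + (\<Sum>i=0..n. ?h i)"
    by (subst sum.atLeast0_atMost_Suc_shift) (simp add: comp_def)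
  \<comment> \<open>The term at \<open>Suc n\<close> vanishes because \<open>n choose Suc n\<close>
    is zero.\<close>
  also have "(\<Sum>i=0..Suc n. ?g i) = (\<Sum>i=0..n. ?g i)" by simp
  also have "\<dots> + (\<Sum>i=0..n. ?h i) = bdiff n (\<lambda>k. f k - f (k - 1)) k"
    unfolding bdiff_def sum.distrib[symmetric] by (intro sum.cong) (auto simp: algebra_simps)
  finally show ?thesis .
qed

lemma bdiff_diff: "bdiff n (\<lambda>k. f k - g k) k = bdiff n f k - bdiff n g k"
  by (simp add: bdiff_def sum_subtractf algebra_simps)

lemma bdiff_sum: "bdiff n (\<lambda>k. \<Sum>x\<in>X. f x k) k = (\<Sum>x\<in>X. bdiff n (f x) k)"
  unfolding bdiff_def sum_distrib_left by (rule sum.swap)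

lemma bdiff_shift: "bdiff n (\<lambda>k. f (k - a)) k = bdiff n f (k - a)"
  by (simp add: bdiff_def algebra_simps)

text \<open>Each difference removes one entry and shifts the argument by its bound. After
  \<open>n\<close> differences only entry \<open>0\<close> is left, and the number of one-entry
  tuples is a step function.\<close>

lemma bdiff_card_tuples:
  "bdiff n (\<lambda>k. int (card (tuples n l k))) k = (if (\<Sum>i\<le>n. l i) \<le> k then 1 else 0)"
proof (induction n arbitrary: k)
  case 0
  show ?case by (simp add: bdiff_def tuples_0)
next
  case (Suc n)
  then show ?case
    by (simp add: bdiff_Suc card_tuples_Suc bdiff_shift[of n "\<lambda>k. int (card (tuples n l k))"]
        algebra_simps)
qed

text \<open>The coefficients of the relation between \<open>e 0, \<dots>, e n\<close>, normalized so that \<open>e n\<close> has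
  coefficient \<open>- q s = - 1\<close>. The coefficients \<open>p r\<close> and \<open>- q s\<close> are those of \<open>e 0\<close> and \<open>e n\<close>.\<close>

definition circuit_coeff :: "nat \<Rightarrow> (nat \<Rightarrow> nat) \<Rightarrow> (nat \<Rightarrow> nat) \<Rightarrow> nat \<Rightarrow> int" where
  "circuit_coeff r p q i = (if i = 0 then int (p r) else if i < r then int (p i) else - int (q (i + 1 - r)))"

section \<open>The vertices, their linear relation and integer combinations\<close>

locale circuit =
  fixes r s n :: nat and p q :: "nat \<Rightarrow> nat" and pos :: "'n::finite \<Rightarrow> nat"
  assumes r: "r \<ge> 1" and s: "s \<ge> 1"
    and p_pos: "\<And>i. i \<in> {1..r} \<Longrightarrow> p i > 0"
    and q_pos: "\<And>j. j \<in> {1..s} \<Longrightarrow> q j > 0"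
    and q_s: "q s = 1"
    and sum_pq: "(\<Sum>i=1..r. p i) = (\<Sum>j=1..s. q j)"
    and n: "n = r + s - 1"
    and bij_pos: "bij_betw pos (UNIV :: 'n set) {1..n}"
begin

abbreviation d :: "nat \<Rightarrow> int" where "d \<equiv> circuit_coeff r p q"
abbreviation e :: "nat \<Rightarrow> real ^ 'n" where "e \<equiv> vert pos r s p q"
definition combo :: "(nat \<Rightarrow> real) \<Rightarrow> real ^ 'n" where "combo c = (\<Sum>i=0..n. c i *\<^sub>R e i)"

lemma d_pos: "i < r \<Longrightarrow> d i > 0"
  using p_pos[of r] p_pos[of i] r by (auto simp: circuit_coeff_def)

lemma d_neg: "r \<le> i \<Longrightarrow> i \<le> n \<Longrightarrow> d i < 0"
proof -
  assume i: "r \<le> i" "i \<le> n"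
  then have "i + 1 - r \<in> {1..s}" using r n s by auto
  from q_pos[OF this] show ?thesis using i r by (auto simp: circuit_coeff_def)
qed

lemma d_n: "d n = -1"
  using q_s r n s by (auto simp: circuit_coeff_def)

text \<open>The entries \<open>d 0, ..., d (r - 1)\<close> are
  \<open>p r, p 1, ..., p (r - 1)\<close>, a rotation that does not affect the sum.\<close>

lemma sum_d_lt:
  fixes f :: "int \<Rightarrow> 'b::comm_monoid_add"
  shows "(\<Sum>i<r. f (d i)) = (\<Sum>i=1..r. f (int (p i)))"
proof -
  obtain r' where r': "r = Suc r'" using r by (cases r) auto
  have "(\<Sum>i<r. f (d i)) = f (d 0) + (\<Sum>i<r'. f (d (Suc i)))"
    unfolding r' by (rule sum.lessThan_Suc_shift)
  also have "(\<Sum>i<r'. f (d (Suc i))) = (\<Sum>i<r'. f (int (p (Suc i))))"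
    by (intro sum.cong) (auto simp: circuit_coeff_def r')
  also have "\<dots> = (\<Sum>i=1..r'. f (int (p i)))"
    using sum.shift_bounds_Suc_ivl[of "\<lambda>i. f (int (p i))" 0 r']
    by (simp add: atLeast0LessThan atLeastLessThanSuc_atLeastAtMost)
  finally show ?thesis by (simp add: r' circuit_coeff_def add.commute)
qed

lemma sum_d_ge:
  fixes f :: "int \<Rightarrow> 'b::comm_monoid_add"
  shows "(\<Sum>i=r..n. f (d i)) = (\<Sum>j=1..s. f (- int (q j)))"
  by (rule sum.reindex_bij_witness[of _ "\<lambda>j. j + r - 1" "\<lambda>i. i + 1 - r"])
    (use r s n in \<open>auto simp: circuit_coeff_def\<close>)

lemma sum_split:
  fixes f :: "nat \<Rightarrow> 'b::comm_monoid_add"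
  shows "(\<Sum>i\<le>n. f i) = (\<Sum>i<r. f i) + (\<Sum>i=r..n. f i)"
proof -
  have "{..n} = {..<r} \<union> {r..n}" using n s by auto
  then show ?thesis by (simp add: sum.union_disjoint ivl_disj_int)
qed

lemma sum_d: "(\<Sum>i\<le>n. d i) = 0"
  using sum_d_lt[of "\<lambda>x. x"] sum_d_ge[of "\<lambda>x. x"] arg_cong[OF sum_pq, of int]
  by (simp add: sum_split sum_negf)

lemma combo_first:
  assumes "pos j = 1"
  shows "combo c $ j = (\<Sum>i\<le>n. c i)"
  unfolding combo_def sum_component atLeast0AtMost
  by (intro sum.cong) (use assms in \<open>auto simp: vert_def vert_coord_def\<close>)

text \<open>Only \<open>e i\<close> and \<open>e n\<close> have a nonzero coordinate number
  \<open>i + 1\<close>, and that of \<open>e n\<close> is \<open>d i\<close>.\<close>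

lemma combo_Suc:
  assumes "pos j = Suc i" "1 \<le> i" "i < n"
  shows "combo c $ j = c i + c n * d i"
proof -
  have v: "e l $ j = (if l = i then 1 else 0) + (if l = n then of_int (d i) else 0)"
    if "l \<le> n" for l
    using that assms n by (auto simp: vert_def vert_coord_def circuit_coeff_def of_nat_diff)
  have "combo c $ j = (\<Sum>l\<le>n. (if l = i then c l else 0) + (if l = n then c l * of_int (d i) else 0))"
    unfolding combo_def sum_component atLeast0AtMost
    by (intro sum.cong) (auto simp: v distrib_left)
  also have "\<dots> = c i + c n * of_int (d i)"
    using assms by (simp add: sum.distrib)
  finally show ?thesis by simp
qed

lemma pos_cases:
  obtains "pos j = 1" | i where "pos j = Suc i" "1 \<le> i" "i < n"
proof -
  have "pos j \<in> {1..n}" using bij_pos by (auto simp: bij_betw_def)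
  then show thesis using that by (metis One_nat_def Suc_le_eq Suc_pred' atLeastAtMost_iff le_antisym not_less_eq_eq)
qed

lemma ex_pos: "m \<in> {1..n} \<Longrightarrow> \<exists>j. pos j = m"
  using bij_pos by (metis bij_betw_imp_surj_on imageE)

lemma n_pos: "n \<ge> 1" using r s n by simp

lemma combo_diff: "combo c - combo c' = combo (\<lambda>i. c i - c' i)"
  by (simp add: combo_def scaleR_diff_left sum_subtractf)

text \<open>The relations among the \<open>e i\<close> are the multiples of \<open>d\<close>.
  Coordinates \<open>2\<close> to \<open>n\<close> express \<open>c i\<close> through
  \<open>c n\<close>; the first coordinate and \<open>sum_d\<close> then determine
  \<open>c 0\<close>. The factor is \<open>- c n\<close> because \<open>d n = -1\<close>.\<close>

lemma combo_eq_0_iff: "combo c = 0 \<longleftrightarrow> (\<forall>i\<le>n. c i = - c n * d i)"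
proof
  assume 0: "combo c = 0"
  have mid: "c i = - c n * d i" if "i \<in> {1..n}" for i
  proof (cases "i = n")
    case False
    then have "Suc i \<in> {1..n}" using that by auto
    from ex_pos[OF this] obtain j where "pos j = Suc i" by auto
    then show ?thesis using combo_Suc[of j i c] 0 False that by auto
  qed (simp add: d_n)
  obtain j where "pos j = 1" using ex_pos[of 1] n_pos by (auto simp del: One_nat_def)
  then have "(\<Sum>i\<le>n. c i) = 0" using combo_first[of j c] 0 by simp
  then have "c 0 + (\<Sum>i=1..n. c i) = 0" by (simp add: sum.atMost_shift[of c] sum.atLeast1_atMost_eq)
  moreover have "(\<Sum>i=1..n. c i) = - c n * (\<Sum>i=1..n. d i)"
    unfolding of_int_sum sum_distrib_left by (intro sum.cong refl mid)
  moreover have "d 0 + (\<Sum>i=1..n. d i) = 0"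
    using sum_d by (simp add: sum.atMost_shift[of d] sum.atLeast1_atMost_eq)
  then have "real_of_int (\<Sum>i=1..n. d i) = - d 0" by linarith
  ultimately have "c 0 = - c n * d 0" by (simp del: of_int_sum)
  then show "\<forall>i\<le>n. c i = - c n * d i" using mid by (metis One_nat_def Suc_leI atLeastAtMost_iff gr0I)
next
  assume c: "\<forall>i\<le>n. c i = - c n * d i"
  have "combo c $ j = 0" for j
  proof (cases rule: pos_cases[of j])
    case 1
    have "(\<Sum>i\<le>n. c i) = (\<Sum>i\<le>n. - c n * d i)"
      by (intro sum.cong refl) (use c in blast)
    also have "\<dots> = - c n * of_int (\<Sum>i\<le>n. d i)" by (simp only: sum_distrib_left of_int_sum)
    finally show ?thesis using 1 sum_d by (simp add: combo_first del: One_nat_def)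
  next
    case (2 i)
    have "c i = - c n * d i" using c 2 by (meson less_imp_le)
    then show ?thesis using combo_Suc[OF 2] by simp
  qed
  then show "combo c = 0" by (simp add: vec_eq_iff)
qed

lemma combo_eq_iff: "combo c = combo c' \<longleftrightarrow> (\<exists>t::real. \<forall>i\<le>n. c i = c' i + t * d i)"
proof -
  have "combo c = combo c' \<longleftrightarrow> combo (\<lambda>i. c i - c' i) = 0"
    by (simp only: combo_diff[symmetric]) simp
  also have "\<dots> \<longleftrightarrow> (\<forall>i\<le>n. c i - c' i = - (c n - c' n) * d i)"
    by (rule combo_eq_0_iff)
  also have "\<dots> \<longleftrightarrow> (\<exists>t::real. \<forall>i\<le>n. c i = c' i + t * d i)"
  proof
    assume "\<forall>i\<le>n. c i - c' i = - (c n - c' n) * d i"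
    then have "\<forall>i\<le>n. c i = c' i + (- (c n - c' n)) * d i"
        by (simp add: algebra_simps)
    then show "\<exists>t::real. \<forall>i\<le>n. c i = c' i + t * d i" by blast
  next
    assume "\<exists>t::real. \<forall>i\<le>n. c i = c' i + t * d i"
    then obtain t :: real where t: "\<And>i. i \<le> n \<Longrightarrow> c i = c' i + t * d i" by auto
    have "t = - (c n - c' n)" using t[of n] d_n by simp
    then show "\<forall>i\<le>n. c i - c' i = - (c n - c' n) * d i" using t by simp
  qed
  finally show ?thesis .
qed

text \<open>As \<open>d n = -1\<close>, adding a multiple of \<open>d\<close> clears the coefficient
  of \<open>e n\<close>. The coefficients of \<open>e 1, ..., e (n - 1)\<close> are then coordinates
  of the vector, and that of \<open>e 0\<close> is the first coordinate minus the others.\<close>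

lemma combo_integral:
  assumes "\<forall>j. combo c $ j \<in> \<int>"
  obtains z :: "nat \<Rightarrow> int" where "combo c = combo (\<lambda>i. of_int (z i))"
proof -
  define y where "y i = c i + c n * d i" for i
  have cy: "combo c = combo y"
    unfolding combo_eq_iff by (rule exI[of _ "- c n"]) (simp add: y_def)
  have yn: "y n = 0" by (simp add: y_def d_n)
  have mid: "y i \<in> \<int>" if "i \<in> {1..n}" for i
  proof (cases "i = n")
    case False
    then have "Suc i \<in> {1..n}" using that by auto
    from ex_pos[OF this] obtain j where "pos j = Suc i" by auto
    then have "combo c $ j = y i" using combo_Suc[of j i c] False that by (auto simp: y_def)
    then show ?thesis using assms by metis
  qed (simp add: yn)
  obtain j where "pos j = 1" using ex_pos[of 1] n_pos by (auto simp del: One_nat_def)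
  then have "(\<Sum>i\<le>n. y i) \<in> \<int>" using combo_first[of j y] cy assms by metis
  moreover have "(\<Sum>i\<le>n. y i) = y 0 + (\<Sum>i=1..n. y i)"
    by (simp add: sum.atMost_shift[of y] sum.atLeast1_atMost_eq)
  moreover have "(\<Sum>i=1..n. y i) \<in> \<int>" using mid by (intro Ints_sum) auto
  ultimately have "y 0 \<in> \<int>" by (metis Ints_diff add_diff_cancel_right')
  then have "y i \<in> \<int>" if "i \<le> n" for i using mid[of i] that by (cases "i = 0") auto
  then have "combo y = combo (\<lambda>i. of_int \<lfloor>y i\<rfloor>)"
    unfolding combo_def by (intro sum.cong) (auto simp: of_int_floor_cancel)
  then show thesis using that cy by metis
qed

lemma combo_of_int: "combo (\<lambda>i. of_int (z i)) $ j \<in> \<int>"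
proof (cases rule: pos_cases[of j])
  case 1
  then show ?thesis by (auto simp: combo_first[OF 1] intro: Ints_sum)
next
  case (2 i)
  then show ?thesis using combo_Suc[OF 2, of "\<lambda>i. of_int (z i)"] by simp
qed

section \<open>Weights, and normal forms of the lattice points of the cone\<close>

text \<open>Every \<open>e i\<close> has first coordinate \<open>1\<close>. A nonzero point of the
  cone divided by its first coordinate is thus a convex combination of the \<open>e i\<close>, while
  the polytope lies where the first coordinate is at most \<open>1\<close>.\<close>

lemma weight_cone:
  assumes v: "v \<in> cone_of n e" and j: "pos j = 1"
  shows "weight (polytope_of n e) v = v $ j"
proof -
  obtain c where c: "v = combo c" "\<And>i. i \<le> n \<Longrightarrow> 0 \<le> c i"
    using v by (auto simp: cone_of_def combo_def)
  have vj: "v $ j = (\<Sum>i\<le>n. c i)" using c j by (simp add: combo_first del: One_nat_def)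
  have nonneg: "0 \<le> v $ j" unfolding vj using c by (intro sum_nonneg) auto
  have ej: "e i $ j = 1" if "i \<le> n" for i
    using that j by (auto simp: vert_def vert_coord_def)
  show ?thesis unfolding weight_def
  proof (rule Least_equality)
    have "v \<in> (\<lambda>x. (v $ j) *\<^sub>R x) ` polytope_of n e"
    proof (cases "v $ j = 0")
      case True
      then have "\<forall>i\<in>{..n}. c i = 0"
        using c vj by (subst sum_nonneg_eq_0_iff[symmetric]) auto
      then have "v = 0" using c by (simp add: combo_def)
      moreover have "0 \<in> polytope_of n e" by (simp add: polytope_of_def hull_inc)
      ultimately show ?thesis by (auto simp: image_iff)
    next
      case False
      define u where "u = (\<Sum>i=0..n. (c i / v $ j) *\<^sub>R e i)"
      have "u \<in> convex hull (insert 0 (e ` {0..n}))" unfolding u_def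
      proof (rule convex_sum)
        show "(\<Sum>i=0..n. c i / v $ j) = 1"
          using False vj by (simp add: sum_divide_distrib[symmetric] atLeast0AtMost)
      qed (use nonneg c in \<open>auto simp: hull_inc\<close>)
      moreover have "v = (v $ j) *\<^sub>R u"
        using False by (simp add: u_def scaleR_sum_right c(1)[unfolded combo_def, symmetric])
      ultimately show ?thesis by (auto simp: polytope_of_def)
    qed
    then show "0 \<le> v $ j \<and> v \<in> (\<lambda>x. (v $ j) *\<^sub>R x) ` polytope_of n e"
      using nonneg by blast
  next
    fix w assume "0 \<le> w \<and> v \<in> (\<lambda>x. w *\<^sub>R x) ` polytope_of n e"
    then obtain x where w: "0 \<le> w" and x: "x \<in> polytope_of n e" and vx: "v = w *\<^sub>R x" by auto
    have "polytope_of n e \<subseteq> {x. x $ j \<le> 1}" unfolding polytope_of_def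
    proof (rule hull_minimal)
      show "convex {x::real^'n. x $ j \<le> 1}"
        using convex_halfspace_le[of "axis j 1" 1] by (simp add: cart_eq_inner_axis inner_commute)
    qed (auto simp: ej)
    then have "x $ j \<le> 1" using x by auto
    then show "v $ j \<le> w" using w by (simp add: vx mult_left_le)
  qed
qed

text \<open>Subtracting a multiple \<open>m\<close> of \<open>d\<close> from \<open>z\<close> shifts the least admissible \<open>x\<close> by \<open>m\<close>; the
  range \<open>(0, 1]\<close> thus selects one tuple in each class modulo \<open>\<int> d\<close>.\<close>

definition fits :: "int \<Rightarrow> (nat \<Rightarrow> int) set" where
  "fits k = {z. (\<forall>i>n. z i = 0) \<and> (\<Sum>i\<le>n. z i) = k \<and>
     (\<exists>x\<in>{0<..1::real}. (\<forall>i\<le>n. d i * x \<le> z i) \<and> (\<exists>i\<in>{r..n}. z i = d i * x))}"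

text \<open>For negative \<open>d i\<close> the inequality \<open>d i * x <= z i\<close> bounds
  \<open>x\<close> from below, so equality at \<open>y\<close> makes \<open>y\<close> a lower bound
  for all admissible \<open>x\<close>.\<close>

lemma tight_le:
  assumes "\<forall>i\<le>n. d i * (x::real) \<le> z i" "i \<in> {r..n}" "z i = d i * (y::real)"
  shows "y \<le> x"
proof -
  have "d i < 0" using d_neg assms by auto
  moreover have "d i * x \<le> d i * y" using assms by auto
  ultimately show ?thesis by (simp add: mult_le_cancel_left)
qed

text \<open>Tuples with the same image differ by \<open>t * d\<close> for an integer
  \<open>t\<close>, and their least admissible \<open>x\<close> differ by \<open>t\<close>; as both
  lie in \<open>(0, 1]\<close>, \<open>t = 0\<close>. Conversely, any integer representation of a
  cone point can be shifted into the normal form.\<close>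

lemma bij_fits:
  assumes j: "pos j = 1"
  shows "bij_betw (\<lambda>z. combo (\<lambda>i. of_int (z i))) (fits k)
    {v \<in> cone_of n e. (\<forall>j. v $ j \<in> \<int>) \<and> v $ j = of_int k}"
  unfolding bij_betw_def
proof (intro conjI inj_onI equalityI subsetI)
  fix z w assume z: "z \<in> fits k" and w: "w \<in> fits k"
    and eq: "combo (\<lambda>i. of_int (z i)) = combo (\<lambda>i. of_int (w i))"
  from eq obtain t :: real where t: "\<And>i. i \<le> n \<Longrightarrow> real_of_int (z i) = w i + t * d i"
    unfolding combo_eq_iff by auto
  from z obtain x :: real and i where x: "x \<in> {0<..1::real}" "\<forall>i\<le>n. d i * x \<le> z i" "i \<in> {r..n}" "z i = d i * x"
    by (auto simp: fits_def)
  from w obtain y :: real and i' where y: "y \<in> {0<..1::real}" "\<forall>i\<le>n. d i * y \<le> w i" "i' \<in> {r..n}" "w i' = d i' * y"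
    by (auto simp: fits_def)
  have "x - t = y"
  \<comment> \<open>Tightness of \<open>z\<close> at \<open>x\<close> becomes tightness of
    \<open>w\<close> at \<open>x - t\<close>, and that of \<open>w\<close> at \<open>y\<close>
    becomes that of \<open>z\<close> at \<open>y + t\<close>.\<close>
  proof (rule antisym)
    show "x - t \<le> y"
      using tight_le[OF y(2) x(3), of "x - t"] t[of i] x by (simp add: algebra_simps)
    have "y + t \<le> x"
      using tight_le[OF x(2) y(3), of "y + t"] t[of i'] y by (simp add: algebra_simps)
    then show "y \<le> x - t" by simp
  qed
  moreover have "t = of_int (w n - z n)" using t[of n] d_n by simp
  ultimately have "\<bar>w n - z n\<bar> < 1" using x y by (simp add: of_int_diff[symmetric] del: of_int_diff)
  then have "t = 0" using \<open>t = of_int (w n - z n)\<close> by simp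
  then have "z i = w i" for i
    using t[of i] z w by (cases "i \<le> n") (auto simp: fits_def)
  then show "z = w" by auto
next
  fix v assume "v \<in> (\<lambda>z. combo (\<lambda>i. of_int (z i))) ` fits k"
  then obtain z where z: "z \<in> fits k" and v: "v = combo (\<lambda>i. of_int (z i))" by auto
  from z obtain x :: real where x: "\<forall>i\<le>n. d i * x \<le> real_of_int (z i)" by (auto simp: fits_def)
  \<comment> \<open>Subtracting \<open>x * d\<close> keeps the vector and makes all coefficients
    nonnegative.\<close>
  have "v = combo (\<lambda>i. z i - x * d i)"
    unfolding v combo_eq_iff by (rule exI[of _ x]) simp
  then have "v \<in> cone_of n e"
    unfolding cone_of_def combo_def using x
    by (auto intro!: exI[of _ "\<lambda>i. z i - x * d i"] simp: mult.commute)
  moreover have "v $ j = of_int k"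
    using z by (simp add: v combo_first[OF j] fits_def of_int_sum[symmetric] del: of_int_sum)
  ultimately show "v \<in> {v \<in> cone_of n e. (\<forall>j. v $ j \<in> \<int>) \<and> v $ j = of_int k}"
    using combo_of_int v by auto
next
  fix v assume "v \<in> {v \<in> cone_of n e. (\<forall>j. v $ j \<in> \<int>) \<and> v $ j = of_int k}"
  then have vc: "v \<in> cone_of n e" and vi: "\<forall>j. v $ j \<in> \<int>" and vk: "v $ j = of_int k" by auto
  obtain c where c: "v = combo c" "\<And>i. i \<le> n \<Longrightarrow> 0 \<le> c i"
    using vc by (auto simp: cone_of_def combo_def)
  obtain y :: "nat \<Rightarrow> int" where y: "combo c = combo (\<lambda>i. of_int (y i))"
    using combo_integral vi c by metis
  then obtain t :: real where t: "\<And>i. i \<le> n \<Longrightarrow> c i = y i + t * d i"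
    unfolding combo_eq_iff by auto
  \<comment> \<open>the least \<open>x\<close> with \<open>d i * x \<le> y i\<close> for all \<open>i\<close>\<close>
  define T where "T = Max ((\<lambda>i. y i / d i) ` {r..n})"
  have ne: "{r..n} \<noteq> {}" using n s r by auto
  then have "T \<in> (\<lambda>i. y i / d i) ` {r..n}" unfolding T_def by (intro Max_in) auto
  then obtain i0 where i0: "i0 \<in> {r..n}" "T = y i0 / d i0" by auto
  \<comment> \<open>Nonnegativity of \<open>c\<close> says that \<open>- t\<close> is admissible for
    \<open>y\<close>.\<close>
  have Tle: "T \<le> - t"
  proof -
    have "d i0 < 0" using d_neg i0 by auto
    moreover from this have "d i0 * - t \<le> d i0 * T"
      using c(2)[of i0] t[of i0] i0 by (simp add: mult.commute)
    ultimately show ?thesis by (simp only: mult_le_cancel_left)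
  qed
  \<comment> \<open>For positive \<open>d i\<close> the inequality passes from \<open>- t\<close>
    down to \<open>T\<close>; for negative \<open>d i\<close> it holds because \<open>T\<close> is
    the maximum.\<close>
  have feas: "d i * T \<le> y i" if "i \<le> n" for i
  proof (cases "i < r")
    case True
    then have "d i * T \<le> d i * (- t)" using d_pos Tle by (intro mult_left_mono) (auto simp: less_imp_le)
    also have "\<dots> \<le> y i" using c(2)[OF that] t[OF that] by (simp add: algebra_simps)
    finally show ?thesis .
  next
    case False
    then have "y i / d i \<le> T" unfolding T_def using that by (intro Max_ge) auto
    then show ?thesis using d_neg[of i] False that by (simp add: field_simps)
  qed
  \<comment> \<open>The unique integer shift that brings \<open>T\<close> into
    \<open>(0, 1]\<close>.\<close>
  define m where "m = \<lceil>T\<rceil> - 1"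
  define z where "z i = (if i \<le> n then y i - m * d i else 0)" for i
  have xT: "T - m \<in> {0<..1}" unfolding m_def by (simp; linarith)
  have "combo (\<lambda>i. of_int (z i)) = v"
    unfolding c(1) y combo_eq_iff by (rule exI[of _ "- of_int m"]) (simp add: z_def)
  moreover have "z \<in> fits k"
  proof -
    have "\<forall>i\<le>n. d i * (T - m) \<le> z i"
      using feas by (simp add: z_def algebra_simps)
    moreover have "z i0 = d i0 * (T - m)"
      using i0 d_neg[of i0] by (simp add: z_def field_simps)
    moreover have "(\<Sum>i\<le>n. z i) = k"
      using vk \<open>combo (\<lambda>i. of_int (z i)) = v\<close> combo_first[OF j, of "\<lambda>i. of_int (z i)"]
      by (metis of_int_eq_iff of_int_sum)
    moreover have "\<forall>i>n. z i = 0" by (simp add: z_def)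
    ultimately show ?thesis unfolding fits_def using xT i0(1) by blast
  qed
  ultimately show "v \<in> (\<lambda>z. combo (\<lambda>i. of_int (z i))) ` fits k" by blast
qed

text \<open>The values prescribed for \<open>k <= 0\<close> are the true counts, since the origin is
  the only point of the cone with first coordinate at most \<open>0\<close>.\<close>

lemma weight_count_eq: "weight_count n e k = card (fits k)"
proof -
  obtain j where j: "pos j = 1" using ex_pos[of 1] n_pos by (auto simp del: One_nat_def)
  let ?S = "{v \<in> cone_of n e. (\<forall>j. v $ j \<in> \<int>) \<and> v $ j = of_int k}"
  have "card (fits k) = card ?S" by (rule bij_betw_same_card[OF bij_fits[OF j]])
  also have "card ?S = weight_count n e k"
  proof (cases "k > 0")
    case True
    then show ?thesis
      by (auto simp: weight_count_def weight_cone[OF _ j] intro!: arg_cong[of _ _ card])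
  next
    case False
    have nonneg: "v $ j \<ge> 0 \<and> (v $ j = 0 \<longrightarrow> v = 0)" if v: "v \<in> cone_of n e" for v
    proof -
      obtain c where c: "v = combo c" "\<And>i. i \<le> n \<Longrightarrow> 0 \<le> c i"
        using v by (auto simp: cone_of_def combo_def)
      then have vj: "v $ j = (\<Sum>i\<le>n. c i)" by (simp add: combo_first[OF j])
      have "v = 0" if "(\<Sum>i\<le>n. c i) = 0"
      proof -
        have "\<forall>i\<in>{..n}. c i = 0"
          using c that by (subst sum_nonneg_eq_0_iff[symmetric]) auto
        then show ?thesis using c by (simp add: combo_def)
      qed
      then show ?thesis unfolding vj using c by (auto intro: sum_nonneg)
    qed
    have "0 \<in> cone_of n e" by (auto simp: cone_of_def intro!: exI[of _ "\<lambda>i. 0"])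
    then have "?S = (if k = 0 then {0} else {})"
      using False nonneg by (auto dest: nonneg)
    then show ?thesis using False by (simp add: weight_count_def)
  qed
  finally show ?thesis by simp
qed

section \<open>Splitting the normal forms by \<open>x\<close>, and the resulting formula for the
  Hodge numbers\<close>

text \<open>The first set holds the integer tuples above \<open>d i * x\<close>, the second those
  strictly above it at every \<open>i >= r\<close>, where strictness for integers means at least the
  floor plus one. The difference requires tightness at some \<open>i >= r\<close>.\<close>

lemma fits_decomp:
  fixes X :: "real set"
  assumes X: "X = {x::real. 0 < x \<and> x \<le> 1 \<and> (\<exists>i\<in>{r..n}. d i * x \<in> \<int>)}"
  shows "fits k = (\<Union>x\<in>X. tuples n (\<lambda>i. \<lceil>d i * x\<rceil>) k
    - tuples n (\<lambda>i. if i < r then \<lceil>d i * x\<rceil> else \<lfloor>d i * x\<rfloor> + 1) k)"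
    (is "_ = (\<Union>x\<in>X. ?A x - ?B x)")
proof (intro equalityI subsetI)
  fix z assume "z \<in> fits k"
  then obtain x :: real and i where x: "x \<in> {0<..1::real}" "\<forall>i\<le>n. d i * x \<le> z i" "i \<in> {r..n}" "z i = d i * x"
    and z: "\<forall>i>n. z i = 0" "(\<Sum>i\<le>n. z i) = k"
    by (auto simp: fits_def)
  have "d i * x \<in> \<int>" using x(4) by (metis Ints_of_int)
  then have "x \<in> X" using x unfolding X by auto
  moreover have "z \<in> ?A x" using x z by (auto simp: tuples_def ceiling_le_iff)
  moreover have "\<lfloor>d i * x\<rfloor> = z i" using x(4) by (metis floor_of_int)
  then have "z \<notin> ?B x" using x by (auto simp: tuples_def intro!: exI[of _ i])
  ultimately show "z \<in> (\<Union>x\<in>X. ?A x - ?B x)" by blast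
next
  fix z assume "z \<in> (\<Union>x\<in>X. ?A x - ?B x)"
  then obtain x :: real where x: "x \<in> X" and A: "z \<in> ?A x" and B: "z \<notin> ?B x" by auto
  have le: "\<forall>i\<le>n. d i * x \<le> z i" using A by (auto simp: tuples_def ceiling_le_iff)
  obtain i where i: "i \<le> n" "r \<le> i" "z i < \<lfloor>d i * x\<rfloor> + 1"
    using A B by (auto simp: tuples_def split: if_splits)
  have "z i \<le> d i * x" using i(3) by linarith
  then have "z i = d i * x" using le i by (auto intro: antisym)
  moreover have "x \<in> {0<..1}" "i \<in> {r..n}" using x i unfolding X by auto
  moreover have "\<forall>i>n. z i = 0" "(\<Sum>i\<le>n. z i) = k" using A by (auto simp: tuples_def)
  ultimately show "z \<in> fits k" unfolding fits_def using le by blast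
qed

text \<open>The pieces for different \<open>x\<close> are disjoint and the removed sets are subsets,
  so \<open>card (fits k)\<close> is a sum of differences of tuple counts, each of which
  \<open>bdiff\<close> turns into a step function.\<close>

lemma hodge_eq_sum:
  fixes X :: "real set"
  assumes X: "X = {x::real. 0 < x \<and> x \<le> 1 \<and> (\<exists>i\<in>{r..n}. d i * x \<in> \<int>)}" and fin: "finite X"
  shows "hodge n e k = (\<Sum>x\<in>X. (if (\<Sum>i\<le>n. \<lceil>d i * x\<rceil>) \<le> k then 1 else 0)
     - (if (\<Sum>i\<le>n. if i < r then \<lceil>d i * x\<rceil> else \<lfloor>d i * x\<rfloor> + 1) \<le> k then 1 else 0))"
proof -
  let ?a = "\<lambda>(x::real) i. \<lceil>d i * x\<rceil>"
  let ?b = "\<lambda>(x::real) i. if i < r then \<lceil>d i * x\<rceil> else \<lfloor>d i * x\<rfloor> + 1"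
  have BA: "tuples n (?b x) k \<subseteq> tuples n (?a x) k" for x :: real and k
  proof -
    have "?a x i \<le> ?b x i" for i by (simp; linarith)
    then show ?thesis unfolding tuples_def by (blast intro: order_trans)
  qed
  have disj: "(tuples n (?a x) k - tuples n (?b x) k) \<inter> (tuples n (?a y) k - tuples n (?b y) k) = {}"
    if "x \<noteq> y" for x y :: real and k
  proof -
    \<comment> \<open>Such a \<open>z\<close> is tight at \<open>y\<close>, so
      \<open>tight_le\<close> applies to the admissible \<open>x\<close>; exchanging the roles gives
      equality.\<close>
    have *: "y \<le> x" if z: "z \<in> tuples n (?a x) k" "z \<in> tuples n (?a y) k" "z \<notin> tuples n (?b y) k"
      for x y :: real and z
    proof -
      obtain i where i: "i \<le> n" "r \<le> i" "z i < \<lfloor>d i * y\<rfloor> + 1"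
        using z(2,3) by (auto simp: tuples_def split: if_splits)
      have "z i \<ge> d i * y" using i z by (auto simp: tuples_def ceiling_le_iff)
      moreover have "z i \<le> d i * y" using i(3) by linarith
      ultimately have "z i = d i * y" by simp
      moreover have "\<forall>i\<le>n. d i * x \<le> z i" using z by (auto simp: tuples_def ceiling_le_iff)
      ultimately show ?thesis using i tight_le[of x z i y] by auto
    qed
    show ?thesis using *[of _ x y] *[of _ y x] that by (auto intro: antisym)
  qed
  have "int (card (fits k)) = (\<Sum>x\<in>X. int (card (tuples n (?a x) k)) - int (card (tuples n (?b x) k)))" for k
  proof -
    have c: "card (fits k) = (\<Sum>x\<in>X. card (tuples n (?a x) k - tuples n (?b x) k))"
      unfolding fits_decomp[OF X]
      by (rule card_UN_disjoint) (use fin finite_tuples disj in auto)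
    show ?thesis unfolding c of_nat_sum
    proof (intro sum.cong refl)
      fix x
      show "int (card (tuples n (?a x) k - tuples n (?b x) k))
          = int (card (tuples n (?a x) k)) - int (card (tuples n (?b x) k))"
        unfolding card_Diff_subset[OF finite_tuples BA]
        by (rule of_nat_diff[OF card_mono[OF finite_tuples BA]])
    qed
  qed
  then have "hodge n e k
      = bdiff n (\<lambda>k. \<Sum>x\<in>X. int (card (tuples n (?a x) k)) - int (card (tuples n (?b x) k))) k"
    by (simp add: hodge_def bdiff_def weight_count_eq)
  then show ?thesis
    by (simp only: bdiff_sum bdiff_diff bdiff_card_tuples)
qed

end

section \<open>The values of \<open>Phi\<close> along the sorted list\<close>

definition sgn_origin :: "real \<times> origin \<Rightarrow> int" where
  "sgn_origin y = (case snd y of Alpha \<Rightarrow> 1 | Beta \<Rightarrow> -1)"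

lemma Phi_eq:
  "i \<le> length xs \<Longrightarrow> Phi r xs i = int r + (\<Sum>y\<leftarrow>take i xs. sgn_origin y)"
  by (induction i) (auto simp: take_Suc_conv_app_nth sgn_origin_def split: origin.split)

text \<open>Since \<open>Beta\<close> comes first at equal values, \<open>(x, Beta)\<close> precedes
  everything else of value at least \<open>x\<close>; its copies directly follow the entries of
  smaller value.\<close>

lemma sorted_block:
  assumes "sorted_wrt beta_first_le xs"
  shows "xs = filter (\<lambda>y. fst y < x) xs @ replicate (count (mset xs) (x, Beta)) (x, Beta)
    @ filter (\<lambda>y. \<not> fst y < x \<and> y \<noteq> (x, Beta)) xs"
  using assms
proof (induction xs)
  case Nil
  then show ?case by simp
next
  case (Cons a ys)
  let ?P = "\<lambda>y. fst y < x" and ?Q = "\<lambda>y. \<not> fst y < x \<and> y \<noteq> (x, Beta)"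
  have IH: "ys = filter ?P ys @ replicate (count (mset ys) (x, Beta)) (x, Beta) @ filter ?Q ys"
    using Cons by simp
  have le: "\<And>y. y \<in> set ys \<Longrightarrow> beta_first_le a y" using Cons by simp
  consider "?P a" | "a = (x, Beta)" | "?Q a" by auto
  then show ?case
  proof cases
    case 1
    then have "a \<noteq> (x, Beta)" by auto
    then show ?thesis using 1 IH by simp
  next
    case 2
    then have "filter ?P ys = []" using le by (fastforce simp: filter_empty_conv beta_first_le_def)
    then show ?thesis using 2 IH by simp
  next
    case 3
    have nP: "filter ?P ys = []"
      using 3 le by (fastforce simp: filter_empty_conv beta_first_le_def)
    \<comment> \<open>An entry of value above \<open>x\<close>, or \<open>(x, Alpha)\<close> itself,
      cannot stand before \<open>(x, Beta)\<close>.\<close>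
    have "snd a = Alpha" if "fst a = x" using that 3 by (cases a; cases "snd a") auto
    then have "(x, Beta) \<notin> set ys" using 3 le[of "(x, Beta)"] by (auto simp: beta_first_le_def)
    then have c0: "count (mset ys) (x, Beta) = 0" by (simp add: count_eq_zero_iff)
    have "filter ?Q ys = ys" using IH unfolding nP c0 by simp
    then show ?thesis using 3 by (simp add: c0 nP)
  qed
qed

text \<open>\<open>P0\<close> is the value of \<open>Phi\<close> just before the block of copies of
  \<open>(x, Beta)\<close>. Each copy lowers it by one, so \<open>P0 - 1, ..., P0 - m\<close> are
  each taken once.\<close>

lemma card_block:
  assumes "sorted_wrt beta_first_le xs"
    and P0_def: "P0 = int r + (\<Sum>y\<in>#filter_mset (\<lambda>y. fst y < x) (mset xs). sgn_origin y)"
    and m_def: "m = count (mset xs) (x, Beta)"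
  shows "card {i \<in> {1..length xs}. xs ! (i - 1) = (x, Beta) \<and> Phi r xs i = k}
    = (if P0 - int m \<le> k \<and> k < P0 then 1 else 0)"
proof -
  define as where "as = filter (\<lambda>y. fst y < x) xs"
  define cs where "cs = filter (\<lambda>y. \<not> fst y < x \<and> y \<noteq> (x, Beta)) xs"
  have xs: "xs = as @ replicate m (x, Beta) @ cs"
    using sorted_block[OF assms(1), of x] unfolding as_def cs_def m_def .
  have P0: "P0 = int r + (\<Sum>y\<leftarrow>as. sgn_origin y)"
    unfolding P0_def as_def by (metis mset_filter mset_map sum_mset_sum_list)
  have nth: "xs ! i = (x, Beta) \<longleftrightarrow> length as \<le> i \<and> i < length as + m" if "i < length xs" for i
  proof (cases "i < length as")
    case True
    then have "xs ! i = as ! i" by (subst xs) (simp add: nth_append)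
    moreover have "as ! i \<in> set as" using True by simp
    ultimately show ?thesis using True by (auto simp: as_def)
  next
    case False
    show ?thesis
    proof (cases "i < length as + m")
      case True
      then show ?thesis using False by (subst xs) (auto simp: nth_append)
    next
      case c: False
      have len: "length xs = length as + m + length cs" by (subst xs) simp
      have "xs ! i = cs ! (i - length as - m)" using c False by (subst xs) (auto simp: nth_append)
      moreover have "cs ! (i - length as - m) \<in> set cs" using that c len by (intro nth_mem) simp
      ultimately show ?thesis using c by (auto simp: cs_def)
    qed
  qed
  have Phi: "Phi r xs (length as + j) = P0 - int j" if "j \<le> m" for j
  proof -
    have "length as + j \<le> length xs" using that by (subst xs) simp
    moreover have "take (length as + j) xs = as @ replicate j (x, Beta)"
      using that by (subst xs) (simp add: min_def)
    ultimately show ?thesis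
      by (simp add: Phi_eq P0 sum_list_replicate sgn_origin_def)
  qed
  have len: "length as + m \<le> length xs" by (subst xs) simp
  \<comment> \<open>The \<open>j\<close>-th copy has list index \<open>length as + j - 1\<close>,
    while \<open>Phi\<close> after it has argument \<open>length as + j\<close>.\<close>
  have "{i \<in> {1..length xs}. xs ! (i - 1) = (x, Beta) \<and> Phi r xs i = k}
      = (\<lambda>j. length as + j) ` {j \<in> {1..m}. P0 - int j = k}"
  proof (intro equalityI subsetI)
    fix i assume "i \<in> {i \<in> {1..length xs}. xs ! (i - 1) = (x, Beta) \<and> Phi r xs i = k}"
    then have i: "1 \<le> i" "i \<le> length xs" "xs ! (i - 1) = (x, Beta)" "Phi r xs i = k" by auto
    then have "length as \<le> i - 1 \<and> i - 1 < length as + m" using nth[of "i - 1"] by auto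
    then have "i = length as + (i - length as)" "i - length as \<in> {1..m}" using i by auto
    moreover have "P0 - int (i - length as) = k"
      using Phi[of "i - length as"] calculation i(4) by auto
    ultimately show "i \<in> (\<lambda>j. length as + j) ` {j \<in> {1..m}. P0 - int j = k}" by blast
  next
    fix i assume "i \<in> (\<lambda>j. length as + j) ` {j \<in> {1..m}. P0 - int j = k}"
    then obtain j where j: "i = length as + j" "1 \<le> j" "j \<le> m" "P0 - int j = k" by auto
    then show "i \<in> {i \<in> {1..length xs}. xs ! (i - 1) = (x, Beta) \<and> Phi r xs i = k}"
      using nth[of "i - 1"] Phi[of j] len by auto
  qed
  then have "card {i \<in> {1..length xs}. xs ! (i - 1) = (x, Beta) \<and> Phi r xs i = k}
      = card {j \<in> {1..m}. P0 - int j = k}"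
    by (simp add: card_image)
  also have "{j \<in> {1..m}. P0 - int j = k} = (if P0 - int m \<le> k \<and> k < P0 then {nat (P0 - k)} else {})"
    by auto
  finally show ?thesis by auto
qed

section \<open>Counting fractions below a given value by floors and ceilings\<close>

lemma sum_fracs:
  "(\<Sum>y\<in>#fracs t p. f y) = (\<Sum>j=1..t. \<Sum>i=1..p j. f (real i / real (p j)))"
  for f :: "real \<Rightarrow> 'b::comm_monoid_add"
proof -
  have "(\<Sum>y\<in>#(\<Sum>j\<in>A. g j). f y) = (\<Sum>j\<in>A. \<Sum>y\<in>#g j. f y)" if "finite A" for A :: "nat set" and g
    using that by (induction A rule: finite_induct) auto
  then show ?thesis unfolding fracs_def
    by (simp add: sum_unfold_sum_mset image_mset.compositionality comp_def)
qed

lemma sum_frac_le: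
  assumes "P > 0" "0 < x" "x \<le> 1"
  shows "(\<Sum>i=1..P. if real i / real P \<le> x then 1 else 0) = \<lfloor>real P * x\<rfloor>"
proof -
  have le: "real P * x \<le> real P" using assms by (simp add: mult_left_le)
  have "{i \<in> {1..P}. real i / real P \<le> x} = {1..nat \<lfloor>real P * x\<rfloor>}"
  proof (intro set_eqI)
    fix i
    have "real i / real P \<le> x \<longleftrightarrow> real i \<le> real P * x" using assms by (simp add: field_simps)
    also have "\<dots> \<longleftrightarrow> int i \<le> \<lfloor>real P * x\<rfloor>" by (simp add: le_floor_iff)
    finally show "i \<in> {i \<in> {1..P}. real i / real P \<le> x} \<longleftrightarrow> i \<in> {1..nat \<lfloor>real P * x\<rfloor>}"
      using le by auto linarith
  qed
  then have "(\<Sum>i=1..P. if real i / real P \<le> x then 1 else 0) = int (card {1..nat \<lfloor>real P * x\<rfloor>})"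
    by (simp add: sum.If_cases Int_def)
  then show ?thesis using assms by simp
qed

text \<open>The condition amounts to \<open>i < \<lceil>real P * x\<rceil>\<close>; the bound
  \<open>x <= 1\<close> keeps these \<open>i\<close> within \<open>1..P\<close>, and
  \<open>x > 0\<close> makes the count nonnegative.\<close>

lemma sum_frac_less:
  assumes "P > 0" "0 < x" "x \<le> 1"
  shows "(\<Sum>i=1..P. if real i / real P < x then 1 else 0) = \<lceil>real P * x\<rceil> - 1"
proof -
  have le: "real P * x \<le> real P" using assms by (simp add: mult_left_le)
  have pos: "0 < real P * x" using assms by simp
  have "{i \<in> {1..P}. real i / real P < x} = {1..nat (\<lceil>real P * x\<rceil> - 1)}"
  proof (intro set_eqI)
    fix i
    have "real i / real P < x \<longleftrightarrow> real i < real P * x" using assms by (simp add: field_simps)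
    also have "\<dots> \<longleftrightarrow> int i < \<lceil>real P * x\<rceil>" by (simp add: less_ceiling_iff)
    finally show "i \<in> {i \<in> {1..P}. real i / real P < x} \<longleftrightarrow> i \<in> {1..nat (\<lceil>real P * x\<rceil> - 1)}"
      using le by auto linarith
  qed
  then have "(\<Sum>i=1..P. if real i / real P < x then 1 else 0)
      = int (card {1..nat (\<lceil>real P * x\<rceil> - 1)})"
    by (simp add: sum.If_cases Int_def)
  moreover have "\<lceil>real P * x\<rceil> \<ge> 1" using pos by simp
  ultimately show ?thesis by simp
qed

lemma sum_filter_mset: "(\<Sum>y\<in>#filter_mset Q M. f y) = (\<Sum>y\<in>#M. if Q y then f y else 0)"
  for f :: "'a \<Rightarrow> 'b::comm_monoid_add"
  by (induction M) auto

lemma count_eq_sum: "int (count M x) = (\<Sum>y\<in>#M. if y = x then 1 else 0)"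
  by (induction M) auto

lemma fracs_less_sum:
  assumes "\<And>j. j \<in> {1..t} \<Longrightarrow> p j > 0" "0 < x" "x \<le> 1"
  shows "(\<Sum>y\<in>#fracs t p. if y < x then 1 else 0) = (\<Sum>j=1..t. \<lceil>real (p j) * x\<rceil>) - int t"
proof -
  have "(\<Sum>y\<in>#fracs t p. if y < x then 1 else 0) = (\<Sum>j=1..t. \<lceil>real (p j) * x\<rceil> - 1)"
    unfolding sum_fracs using assms by (intro sum.cong refl sum_frac_less) auto
  then show ?thesis by (simp add: sum_subtractf)
qed

text \<open>The multiplicity of \<open>x\<close> is the number of entries at most \<open>x\<close>
  minus the number below \<open>x\<close>.\<close>

lemma count_fracs:
  assumes "\<And>j. j \<in> {1..t} \<Longrightarrow> p j > 0" "0 < x" "x \<le> 1"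
  shows "int (count (fracs t p) x)
    = (\<Sum>j=1..t. \<lfloor>real (p j) * x\<rfloor>) - (\<Sum>j=1..t. \<lceil>real (p j) * x\<rceil>) + int t"
proof -
  have "int (count (fracs t p) x) + (\<Sum>y\<in>#fracs t p. if y < x then 1 else 0)
      = (\<Sum>y\<in>#fracs t p. if y \<le> x then 1 else 0)"
    unfolding count_eq_sum sum_mset.distrib[symmetric]
    by (intro arg_cong[of _ _ sum_mset] image_mset_cong) auto
  also have "\<dots> = (\<Sum>j=1..t. \<lfloor>real (p j) * x\<rfloor>)"
    unfolding sum_fracs using assms by (intro sum.cong refl sum_frac_le) auto
  finally show ?thesis using fracs_less_sum[OF assms] by simp
qed

lemma size_fracs: "size (fracs t p) = (\<Sum>j=1..t. p j)"
  using sum_fracs[of "\<lambda>_. 1::nat" t p] by simp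

lemma set_fracs: "set_mset (fracs t p) = {real i / real (p j) | i j. j \<in> {1..t} \<and> i \<in> {1..p j}}"
proof -
  have "set_mset (\<Sum>j\<in>A. g j) = (\<Union>j\<in>A. set_mset (g j))" if "finite A" for A :: "nat set" and g :: "nat \<Rightarrow> real multiset"
    using that by (induction A rule: finite_induct) auto
  then have "set_mset (fracs t p) = (\<Union>j\<in>{1..t}. (\<lambda>i. real i / real (p j)) ` {1..p j})"
    unfolding fracs_def by simp
  then show ?thesis by blast
qed

section \<open>Comparison of the Hodge numbers with the values of \<open>Phi\<close>\<close>

context circuit
begin

text \<open>For \<open>i >= r\<close> the coefficient \<open>d i\<close> is some
  \<open>- q j\<close>, and \<open>q j * x\<close> is an integer for \<open>x\<close> in
  \<open>(0, 1]\<close> exactly when \<open>x\<close> is one of the fractions with denominator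
  \<open>q j\<close>.\<close>

lemma set_fracs_eq:
  "{x::real. 0 < x \<and> x \<le> 1 \<and> (\<exists>i\<in>{r..n}. d i * x \<in> \<int>)} = set_mset (fracs s q)"
proof (intro equalityI subsetI)
  fix x assume "x \<in> {x::real. 0 < x \<and> x \<le> 1 \<and> (\<exists>i\<in>{r..n}. d i * x \<in> \<int>)}"
  then obtain i where x: "0 < x" "x \<le> 1" and i: "r \<le> i" "i \<le> n" and di: "d i * x \<in> \<int>" by auto
  let ?j = "i + 1 - r"
  have j: "?j \<in> {1..s}" using i r s n by auto
  have dq: "d i = - int (q ?j)" using i r by (simp add: circuit_coeff_def)
  have "real (q ?j) * x = - (d i * x)" unfolding dq by simp
  then obtain z :: int where z: "real (q ?j) * x = z" using di by (metis Ints_cases Ints_minus)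
  have qpos: "q ?j > 0" using q_pos j by blast
  then have "0 < real (q ?j) * x" "real (q ?j) * x \<le> real (q ?j)" using x by (auto simp: mult_left_le)
  then have "nat z \<in> {1..q ?j}" unfolding z by auto
  moreover have "x = real (nat z) / real (q ?j)"
    using z qpos \<open>0 < real (q ?j) * x\<close> by (simp add: field_simps)
  ultimately show "x \<in> set_mset (fracs s q)" unfolding set_fracs using j by blast
next
  fix x assume "x \<in> set_mset (fracs s q)"
  then obtain i j where x: "x = real i / real (q j)" and j: "j \<in> {1..s}" and i: "i \<in> {1..q j}"
    unfolding set_fracs by blast
  have "j + r - 1 \<in> {r..n}" "d (j + r - 1) = - int (q j)" using j r n by (auto simp: circuit_coeff_def)
  moreover have "- int (q j) * x = - int i" using x i by simp
  moreover have "0 < x" "x \<le> 1" using x i by auto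
  ultimately show "x \<in> {x::real. 0 < x \<and> x \<le> 1 \<and> (\<exists>i\<in>{r..n}. d i * x \<in> \<int>)}"
    by (auto intro!: bexI[of _ "j + r - 1"])
qed

lemma sum_ceiling_d:
  fixes x :: real
  shows "(\<Sum>i\<le>n. \<lceil>d i * x\<rceil>) = (\<Sum>j=1..r. \<lceil>real (p j) * x\<rceil>) - (\<Sum>j=1..s. \<lfloor>real (q j) * x\<rfloor>)"
  unfolding sum_split sum_d_lt[of "\<lambda>t. \<lceil>t * x\<rceil>"] sum_d_ge[of "\<lambda>t. \<lceil>t * x\<rceil>"]
  by (simp add: ceiling_minus sum_negf)

text \<open>By \<open>count_fracs\<close>, this exceeds the sum in \<open>sum_ceiling_d\<close> by
  the multiplicity of \<open>x\<close> in \<open>fracs s q\<close>.\<close>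

lemma sum_strict_d:
  fixes x :: real
  shows "(\<Sum>i\<le>n. if i < r then \<lceil>d i * x\<rceil> else \<lfloor>d i * x\<rfloor> + 1)
     = (\<Sum>j=1..r. \<lceil>real (p j) * x\<rceil>) - (\<Sum>j=1..s. \<lceil>real (q j) * x\<rceil>) + int s"
proof -
  have "(\<Sum>i\<le>n. if i < r then \<lceil>d i * x\<rceil> else \<lfloor>d i * x\<rfloor> + 1)
      = (\<Sum>i<r. \<lceil>d i * x\<rceil>) + (\<Sum>i=r..n. \<lfloor>d i * x\<rfloor> + 1)"
    unfolding sum_split by (intro arg_cong2[of _ _ _ _ "(+)"] sum.cong) auto
  also have "\<dots> = (\<Sum>j=1..r. \<lceil>real (p j) * x\<rceil>) + (\<Sum>j=1..s. 1 - \<lceil>real (q j) * x\<rceil>)"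
    unfolding sum_d_lt[of "\<lambda>t. \<lceil>t * x\<rceil>"] sum_d_ge[of "\<lambda>t. \<lfloor>t * x\<rfloor> + 1"]
    by (simp add: floor_minus)
  finally show ?thesis by (simp add: sum_subtractf)
qed

lemma hodge_eq_card:
  assumes "is_merged_sort r s p q \<mu>"
  shows "hodge n e k = int (card {i \<in> {1..length \<mu>}. snd (\<mu> ! (i - 1)) = Beta \<and> Phi r \<mu> i = k})"
proof -
  define X where "X = {x::real. 0 < x \<and> x \<le> 1 \<and> (\<exists>i\<in>{r..n}. d i * x \<in> \<int>)}"
  have X: "X = set_mset (fracs s q)" unfolding X_def by (rule set_fracs_eq)
  have mset: "mset \<mu> = tagged_fracs r s p q" and sorted: "sorted_wrt beta_first_le \<mu>"
    using assms by (auto simp: is_merged_sort_def)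
  let ?S = "\<lambda>x. {i \<in> {1..length \<mu>}. \<mu> ! (i - 1) = (x, Beta) \<and> Phi r \<mu> i = k}"
  have "{i \<in> {1..length \<mu>}. snd (\<mu> ! (i - 1)) = Beta \<and> Phi r \<mu> i = k} = (\<Union>x\<in>X. ?S x)"
  proof (intro equalityI subsetI)
    fix i assume i: "i \<in> {i \<in> {1..length \<mu>}. snd (\<mu> ! (i - 1)) = Beta \<and> Phi r \<mu> i = k}"
    obtain x where x: "\<mu> ! (i - 1) = (x, Beta)" using i by (cases "\<mu> ! (i - 1)") auto
    have "\<mu> ! (i - 1) \<in> set \<mu>" using i by (intro nth_mem) auto
    then have "(x, Beta) \<in># tagged_fracs r s p q" unfolding mset[symmetric] x by simp
    then have "x \<in> X" unfolding X tagged_fracs_def by auto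
    then show "i \<in> (\<Union>x\<in>X. ?S x)" using i x by auto
  qed auto
  \<comment> \<open>Each position carries one value, so the sets for distinct \<open>x\<close> are
    disjoint.\<close>
  then have "card {i \<in> {1..length \<mu>}. snd (\<mu> ! (i - 1)) = Beta \<and> Phi r \<mu> i = k} = (\<Sum>x\<in>X. card (?S x))"
    by (simp only:) (rule card_UN_disjoint; auto simp: X)
  moreover have "int (card (?S x)) = (if (\<Sum>i\<le>n. \<lceil>d i * x\<rceil>) \<le> k then 1 else 0)
     - (if (\<Sum>i\<le>n. if i < r then \<lceil>d i * x\<rceil> else \<lfloor>d i * x\<rfloor> + 1) \<le> k then 1 else 0)"
    if "x \<in> X" for x :: real
  proof -
    have x: "0 < x" "x \<le> 1" using that by (auto simp: X_def)
    have m: "count (mset \<mu>) (x, Beta) = count (fracs s q) x"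
    proof -
      have "count (image_mset (\<lambda>x. (x, Alpha)) M) (x, Beta) = 0" for M :: "real multiset"
        by (induction M) auto
      moreover have "count (image_mset (\<lambda>x. (x, Beta)) M) (x, Beta) = count M x" for M :: "real multiset"
        by (induction M) auto
      ultimately show ?thesis by (simp add: mset tagged_fracs_def)
    qed
    let ?P0 = "int r + (\<Sum>y\<in>#filter_mset (\<lambda>y. fst y < x) (mset \<mu>). sgn_origin y)"
    have "(\<Sum>y\<in>#M. if y < x then - 1 else 0) = - (\<Sum>y\<in>#M. if y < x then 1 else (0::int))"
      for M :: "real multiset"
      by (induction M) auto
    then have P0: "?P0 = int r + (\<Sum>y\<in>#fracs r p. if y < x then 1 else 0)
        - (\<Sum>y\<in>#fracs s q. if y < x then 1 else 0)"
      unfolding sum_filter_mset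
      by (simp add: mset tagged_fracs_def image_mset.compositionality comp_def sgn_origin_def cong: if_cong)
    \<comment> \<open>The starting value \<open>r\<close> cancels the \<open>- r\<close> from
      counting the alpha entries below \<open>x\<close>; counting the beta entries contributes
      \<open>+ s\<close>.\<close>
    have "?P0 = (\<Sum>i\<le>n. if i < r then \<lceil>d i * x\<rceil> else \<lfloor>d i * x\<rfloor> + 1)"
      unfolding P0 sum_strict_d using fracs_less_sum[of r p x] fracs_less_sum[of s q x] p_pos q_pos x
      by simp
    moreover have "?P0 - int (count (mset \<mu>) (x, Beta)) = (\<Sum>i\<le>n. \<lceil>d i * x\<rceil>)"
      unfolding calculation sum_strict_d sum_ceiling_d m using count_fracs[of s q x] q_pos x
      by simp
    \<comment> \<open>As the multiplicity is nonnegative, the difference of the two step functions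
      is the indicator of an interval.\<close>
    moreover have "(0::int) \<le> int (count (mset \<mu>) (x, Beta))" by simp
    ultimately show ?thesis
      unfolding card_block[OF sorted refl refl, of x r k] by (simp split: if_splits; linarith)
  qed
  ultimately show ?thesis
    by (simp add: hodge_eq_sum[OF X_def] X)
qed

end

theorem theorem2p2:
  fixes r s L n :: nat
    and p q :: "nat \<Rightarrow> nat"
    and pos :: "'n::finite \<Rightarrow> nat"
    and \<mu> :: "(real \<times> origin) list"
    and k :: int
  assumes "r \<ge> 1" and "s \<ge> 1"
    and "\<And>i. i \<in> {1..r} \<Longrightarrow> p i > 0"
    and "\<And>j. j \<in> {1..s} \<Longrightarrow> q j > 0"
    and "p ` {1..r} \<inter> q ` {1..s} = {}"
    and "q s = 1"
    and "(\<Sum>i=1..r. p i) = L" and "(\<Sum>j=1..s. q j) = L"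
    and "n = r + s - 1"
    and "bij_betw pos (UNIV :: 'n set) {1..n}"
    and "is_merged_sort r s p q \<mu>"
  shows "hodge n (vert pos r s p q) k =
    int (card {i \<in> {1..2 * L}. snd (\<mu> ! (i - 1)) = Beta \<and> Phi r \<mu> i = k})"
proof -
  interpret circuit r s n p q pos
    using assms by unfold_locales auto
  have "length \<mu> = size (tagged_fracs r s p q)"
    using assms(11) by (metis is_merged_sort_def size_mset)
  also have "\<dots> = 2 * L" using assms(7,8) by (simp add: tagged_fracs_def size_fracs)
  finally show ?thesis using hodge_eq_card[OF assms(11), of k] by simp
qed

end
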